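(* Let $\varepsilon>0$ be sufficiently small, let $\alpha\ge1500\varepsilon^{-2}$, let $G$ be an $\alpha$-pseudo-random graph on $[n]$, let $v_0\in[n]$, let $L_2=(2+\varepsilon)n\ln n$, and let $\Gamma=\Gamma^{v_0}_{L_2}(G)$ be the trace of a $\frac12$-lazy simple random walk of length $L_2$ on $G$ starting at $v_0$. Then with high probability there is an edge of $\Gamma$ between every pair of disjoint subsets $A,B\subseteq[n]$ with $|A|,|B|\ge\frac{n(\ln\ln n)^{1.5}}{\ln n}$.
   Context: A graph $G$ on $[n]$ is $\alpha$-pseudo-random (for $\alpha=\alpha(n)>0$) if: (P1) $G$ is connected; (P2) for every $v$, $|d(v)-\alpha\ln n|\le2\sqrt\alpha\ln n$ and $\frac{5\alpha}{6}\ln n\le d(v)\le\frac{4\alpha}{3}\ln n$; (P3) for every non-empty $S\subseteq[n]$ with $|S|\le0.8n$, $|\partial S|>\frac{|S||S^c|\alpha\ln n}{2n}$; (P4) for every large enough constant $K>0$ and every non-empty $A$ with $|A|=a$: if $\frac n{\alpha\ln n}\le a\le\frac n{\ln n}$ then $|E(A,\{u\in N(A):|E(u,A)|\ge Ka\alpha\ln n/n\})|\le a\alpha\ln n/K$, and if $a<\frac n{\alpha\ln n}$ then $|E(A,\{u\in N(A):|E(u,A)|\ge K\})|\le a\alpha\ln n/\ln K$; (P5) for every $A$ with $|A|=n(\ln\ln n)^{1.5}/\ln n$ at most $|A|/2$ vertices $v\notin A$ have $|E(v,A)|\le\alpha(\ln\ln n)^{1.5}/2$; (P6) if $\alpha<\ln^2n$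 then for every $v$, every $0\le r\le\frac{\ln n}{15\ln\ln n}$ and every $w\in N(v,r)$, $|E(w,B(v,r))|\le5$. Here $E(A,B)$ is the set of edges between $A$ and $B$, $N(A)$ the external neighbourhood, $\partial S$ the edge boundary, $B(v,r)$ the ball of radius $r$ around $v$ in graph distance, $N(v,r)=B(v,r)\setminus B(v,r-1)$. A $\frac12$-lazy random walk stays put with probability $1/2$ at each step and otherwise moves to a uniformly random neighbour. The trace is the multigraph on $[n]$ of traversed edges. "With high probability" means with probability tending to $1$ as $n\to\infty$. *)

theory Defs
  imports "HOL-Probability.Probability" "HOL-Library.Multiset" "HOL-Library.Extended_Nat"
begin

text \<open>A simple graph on the vertex set \<open>{1..n}\<close> is given by its set of edges, which are two-element
  subsets of \<open>{1..n}\<close>.\<close>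

type_synonym graph = "nat set set"

definition graph_on :: "nat \<Rightarrow> graph \<Rightarrow> bool" where
  "graph_on n E \<longleftrightarrow> (\<forall>e\<in>E. e \<subseteq> {1..n} \<and> card e = 2)"

definition nbrs :: "graph \<Rightarrow> nat \<Rightarrow> nat set" where
  "nbrs E v = {u. {v, u} \<in> E}"

definition deg :: "graph \<Rightarrow> nat \<Rightarrow> nat" where
  "deg E v = card (nbrs E v)"

definition ext_nbrs :: "graph \<Rightarrow> nat set \<Rightarrow> nat set" where
  "ext_nbrs E A = {u. u \<notin> A \<and> (\<exists>v\<in>A. {v, u} \<in> E)}"

definition edges_between :: "graph \<Rightarrow> nat set \<Rightarrow> nat set \<Rightarrow> nat set set" where
  "edges_between E A B = {e \<in> E. \<exists>a\<in>A. \<exists>b\<in>B. e = {a, b}}"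

definition edge_boundary :: "nat \<Rightarrow> graph \<Rightarrow> nat set \<Rightarrow> nat set set" where
  "edge_boundary n E S = edges_between E S ({1..n} - S)"

definition adj_rel :: "graph \<Rightarrow> (nat \<times> nat) set" where
  "adj_rel E = {(u, v). {u, v} \<in> E}"

definition graph_connected :: "nat \<Rightarrow> graph \<Rightarrow> bool" where
  "graph_connected n E \<longleftrightarrow> (\<forall>u\<in>{1..n}. \<forall>v\<in>{1..n}. (u, v) \<in> (adj_rel E)\<^sup>*)"

text \<open>The infimum of the empty set is \<open>\<infinity>\<close>.\<close>

definition graph_dist :: "graph \<Rightarrow> nat \<Rightarrow> nat \<Rightarrow> enat" where
  "graph_dist E u v = (INF k\<in>{k. (u, v) \<in> adj_rel E ^^ k}. enat k)"

definition graph_ball :: "nat \<Rightarrow> graph \<Rightarrow> nat \<Rightarrow> nat \<Rightarrow> nat set" where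
  "graph_ball n E v r = {w \<in> {1..n}. graph_dist E v w \<le> enat r}"

text \<open>The ball of radius \<open>-1\<close> is empty.\<close>

definition graph_sphere :: "nat \<Rightarrow> graph \<Rightarrow> nat \<Rightarrow> nat \<Rightarrow> nat set" where
  "graph_sphere n E v r = graph_ball n E v r - (if r = 0 then {} else graph_ball n E v (r - 1))"


definition large_size :: "nat \<Rightarrow> real" where
  "large_size n = real n * ln (ln (real n)) powr (3/2) / ln (real n)"

definition degrees_ok :: "nat \<Rightarrow> real \<Rightarrow> graph \<Rightarrow> bool" where
  "degrees_ok n \<alpha> E \<longleftrightarrow> (\<forall>v\<in>{1..n}.
     \<bar>real (deg E v) - \<alpha> * ln (real n)\<bar> \<le> 2 * sqrt \<alpha> * ln (real n) \<and>
     5 * \<alpha> / 6 * ln (real n) \<le> real (deg E v) \<and>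
     real (deg E v) \<le> 4 * \<alpha> / 3 * ln (real n))"

definition edge_expanding :: "nat \<Rightarrow> real \<Rightarrow> graph \<Rightarrow> bool" where
  "edge_expanding n \<alpha> E \<longleftrightarrow> (\<forall>S\<subseteq>{1..n}. S \<noteq> {} \<longrightarrow> real (card S) \<le> 8/10 * real n \<longrightarrow>
     real (card (edge_boundary n E S)) >
       real (card S) * real (card ({1..n} - S)) * \<alpha> * ln (real n) / (2 * real n))"

definition few_concentrated_edges :: "real \<Rightarrow> nat \<Rightarrow> real \<Rightarrow> graph \<Rightarrow> bool" where
  "few_concentrated_edges K n \<alpha> E \<longleftrightarrow> (\<forall>A\<subseteq>{1..n}. A \<noteq> {} \<longrightarrow>
     (let a = real (card A) in
       (real n / (\<alpha> * ln (real n)) \<le> a \<and> a \<le> real n / ln (real n) \<longrightarrow>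
          real (card (edges_between E A
            {u \<in> ext_nbrs E A. real (card (edges_between E {u} A)) \<ge> K * a * \<alpha> * ln (real n) / real n}))
          \<le> a * \<alpha> * ln (real n) / K) \<and>
       (a < real n / (\<alpha> * ln (real n)) \<longrightarrow>
          real (card (edges_between E A
            {u \<in> ext_nbrs E A. real (card (edges_between E {u} A)) \<ge> K}))
          \<le> a * \<alpha> * ln (real n) / ln K)))"

text \<open>The prescribed size of \<open>A\<close> is rounded up to an integer.\<close>

definition few_poorly_joined :: "nat \<Rightarrow> real \<Rightarrow> graph \<Rightarrow> bool" where
  "few_poorly_joined n \<alpha> E \<longleftrightarrow> (\<forall>A\<subseteq>{1..n}. int (card A) = \<lceil>large_size n\<rceil> \<longrightarrow>
     real (card {v \<in> {1..n} - A.
       real (card (edges_between E {v} A)) \<le> \<alpha> * ln (ln (real n)) powr (3/2) / 2})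
     \<le> real (card A) / 2)"

definition locally_sparse :: "nat \<Rightarrow> real \<Rightarrow> graph \<Rightarrow> bool" where
  "locally_sparse n \<alpha> E \<longleftrightarrow> (\<alpha> < (ln (real n))\<^sup>2 \<longrightarrow>
     (\<forall>v\<in>{1..n}. \<forall>r::nat. real r \<le> ln (real n) / (15 * ln (ln (real n))) \<longrightarrow>
       (\<forall>w\<in>graph_sphere n E v r. card (edges_between E {w} (graph_ball n E v r)) \<le> 5)))"

text \<open>Pseudo-randomness is a property of a sequence of graphs \<open>G n\<close> on \<open>{1..n}\<close>. The constants \<open>K\<close>
  and the threshold \<open>K0\<close> must not depend on \<open>n\<close>: for a single finite graph the condition on \<open>K\<close>
  holds trivially once \<open>K\<close> is large enough. Nothing is required of small \<open>n\<close>; there the degree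
  condition may not be satisfiable at all, e.g. when \<open>5 * \<alpha> n / 6 * ln n \<ge> n\<close>.\<close>

definition pseudo_random :: "(nat \<Rightarrow> real) \<Rightarrow> (nat \<Rightarrow> graph) \<Rightarrow> bool" where
  "pseudo_random \<alpha> G \<longleftrightarrow>
     (\<forall>\<^sub>F n in sequentially.
        \<alpha> n > 0 \<and> graph_on n (G n) \<and> graph_connected n (G n) \<and>
        degrees_ok n (\<alpha> n) (G n) \<and> edge_expanding n (\<alpha> n) (G n) \<and>
        few_poorly_joined n (\<alpha> n) (G n) \<and> locally_sparse n (\<alpha> n) (G n)) \<and>
     (\<exists>K0>0. \<forall>K\<ge>K0. \<forall>\<^sub>F n in sequentially. few_concentrated_edges K n (\<alpha> n) (G n))"


text \<open>Meaningful only when \<open>nbrs E v\<close> is finite and nonempty, which is the case for every vertex \<open>v\<close>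
  of a connected graph on at least two vertices.\<close>

definition lazy_step :: "graph \<Rightarrow> nat \<Rightarrow> nat pmf" where
  "lazy_step E v = bind_pmf (bernoulli_pmf (1/2))
     (\<lambda>stay. if stay then return_pmf v else pmf_of_set (nbrs E v))"

text \<open>The law of the list of the \<open>L + 1\<close> positions of the walk of length \<open>L\<close>.\<close>

fun lazy_walk :: "graph \<Rightarrow> nat \<Rightarrow> nat \<Rightarrow> nat list pmf" where
  "lazy_walk E v 0 = return_pmf [v]"
| "lazy_walk E v (Suc L) =
     bind_pmf (lazy_step E v) (\<lambda>w. map_pmf (\<lambda>xs. v # xs) (lazy_walk E w L))"

text \<open>The edges of the trace, with multiplicity; steps at which the walk stays put traverse no
  edge.\<close>

definition traversed :: "nat list \<Rightarrow> nat set multiset" where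
  "traversed xs = mset (map (\<lambda>(x, y). {x, y}) (filter (\<lambda>(x, y). x \<noteq> y) (zip xs (tl xs))))"

definition walk_trace :: "graph \<Rightarrow> nat \<Rightarrow> nat \<Rightarrow> nat set multiset pmf" where
  "walk_trace E v L = map_pmf traversed (lazy_walk E v L)"

end

theory Submission imports Defs "HOL-Real_Asymp.Real_Asymp" begin

text \<open>Fix disjoint \<open>A\<close>, \<open>B\<close> of the minimal size \<open>s = \<lceil>large_size n\<rceil>\<close>. The probability \<open>u L x\<close> that a walk from
  \<open>x\<close> crosses no \<open>A\<close>-\<open>B\<close> edge in \<open>L\<close> steps evolves under the transition operator with these edges
  killed. By (P2) and (P3) the graph has a spectral gap bounded below by an absolute constant (Cheeger), so
  killing \<open>M\<close> edges decreases the degree-weighted \<open>L\<^sup>2\<close> norm at every step by a relative amount of order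
  \<open>M / (n \<alpha> ln n)\<close>. By (P5), \<open>M\<close> is of order at least \<open>s \<alpha> (ln ln n)\<^bsup>3/2\<^esup>\<close>, hence after \<open>n ln n\<close> steps the
  probability is at most \<open>sqrt (2 n) exp (- c s (ln ln n)\<^bsup>3/2\<^esup>)\<close>. There are only \<open>exp (O(s ln ln n))\<close> pairs
  \<open>(A, B)\<close>, so a union bound suffices.\<close>

section \<open>Cheeger and Poincare inequalities on a finite weighted graph\<close>

text \<open>Peel off the level set \<open>{g > 0}\<close> at the height of its smallest value.\<close>

lemma coarea_inequality:
  fixes w :: "'a \<Rightarrow> 'a \<Rightarrow> real" and g :: "'a \<Rightarrow> real"
  assumes V: "finite V"
    and sym: "\<And>x y. w x y = w y x"
    and iso: "\<And>S. S \<subseteq> V \<Longrightarrow> 2 * card S \<le> card V \<Longrightarrow> h * real (card S) \<le> (\<Sum>x\<in>S. \<Sum>y\<in>V - S. w x y)"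
    and "\<And>x. x \<in> V \<Longrightarrow> 0 \<le> g x"
    and "2 * card {x\<in>V. 0 < g x} \<le> card V"
  shows "2 * h * (\<Sum>x\<in>V. g x) \<le> (\<Sum>x\<in>V. \<Sum>y\<in>V. w x y * \<bar>g x - g y\<bar>)"
  using assms(4,5)
proof (induction "card {x\<in>V. 0 < g x}" arbitrary: g rule: less_induct)
  case less
  define S where "S = {x\<in>V. 0 < g x}"
  show ?case
  proof (cases "S = {}")
    case True
    then have "\<forall>x\<in>V. g x = 0" using less.prems(1) by (force simp: S_def)
    then show ?thesis by simp
  next
    case False
    have S: "finite S" "S \<subseteq> V" using V by (auto simp: S_def)
    define m where "m = Min (g ` S)"
    have mle: "m \<le> g x" if "x \<in> S" for x using S that by (simp add: m_def)
    obtain z where z: "z \<in> S" "g z = m"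
      using Min_in[of "g ` S"] S False by (fastforce simp: m_def)
    have m0: "0 < m" using z by (auto simp: S_def)
    have out: "g x = 0" if "x \<in> V" "x \<notin> S" for x
      using less.prems(1)[OF that(1)] that by (simp add: S_def)
    \<comment> \<open>Lowering \<open>g\<close> by its minimum on \<open>S\<close> sends at least
      the minimiser \<open>z\<close> to 0 and creates no new positive value. The positive set
      shrinks strictly, which drives the induction and keeps it within half of
      \<open>V\<close>.\<close>
    define g' where "g' x = g x - m * indicator S x" for x
    have g'0: "0 \<le> g' x" if "x \<in> V" for x
      using mle[of x] less.prems(1)[OF that] by (auto simp: g'_def indicator_def)
    have "{x\<in>V. 0 < g' x} \<subseteq> S - {z}"
      using out z by (auto simp: g'_def S_def indicator_def split: if_splits)
    then have cl: "card {x\<in>V. 0 < g' x} < card S"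
      using S z by (metis card_Diff1_less card_mono finite_Diff le_less_trans)
    have IH: "2 * h * (\<Sum>x\<in>V. g' x) \<le> (\<Sum>x\<in>V. \<Sum>y\<in>V. w x y * \<bar>g' x - g' y\<bar>)"
      using cl less.prems(2) g'0 by (intro less.hyps) (auto simp: S_def)
    have sumg: "(\<Sum>x\<in>V. g x) = (\<Sum>x\<in>V. g' x) + m * real (card S)"
      using V S by (simp add: g'_def sum_subtractf sum_distrib_left[symmetric] Int_absorb1 indicator_def[abs_def]
        flip: sum.inter_filter)
    \<comment> \<open>\<open>c\<close> marks the ordered pairs with exactly one end in
      \<open>S\<close>. The end outside has value 0, so passing from \<open>g\<close> to
      \<open>g'\<close> reduces the difference by exactly \<open>m\<close>; for two ends in
      \<open>S\<close> the shift cancels. Each boundary pair occurs in both orders, whence the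
      factor 2 in the claim.\<close>
    define c where "c x y = (indicator S x * indicator (V - S) y + indicator (V - S) x * indicator S y :: real)" for x y
    have split: "w x y * \<bar>g x - g y\<bar> = w x y * \<bar>g' x - g' y\<bar> + m * (w x y * c x y)"
      if "x \<in> V" "y \<in> V" for x y
      using that mle[of x] mle[of y] out[of x] out[of y] m0
      by (cases "x \<in> S"; cases "y \<in> S") (auto simp: g'_def c_def algebra_simps)
    have half: "(\<Sum>x\<in>V. \<Sum>y\<in>V. w x y * (indicator S x * indicator (V - S) y)) = (\<Sum>x\<in>S. \<Sum>y\<in>V - S. w x y)"
    proof -
      have "(\<Sum>x\<in>V. \<Sum>y\<in>V. w x y * (indicator S x * indicator (V - S) y))
          = (\<Sum>x\<in>V. indicator S x * (\<Sum>y\<in>V. w x y * indicator (V - S) y))"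
        by (simp add: sum_distrib_left mult_ac)
      also have "\<dots> = (\<Sum>x\<in>S. \<Sum>y\<in>V. w x y * indicator (V - S) y)"
        using V S by (simp add: sum.inter_restrict[symmetric] indicator_def if_distrib Int_absorb1 flip: sum.inter_filter cong: if_cong)
      also have "\<dots> = (\<Sum>x\<in>S. \<Sum>y\<in>V - S. w x y)"
        using V by (intro sum.cong refl sum.mono_neutral_cong_right) (auto simp: indicator_def)
      finally show ?thesis .
    qed
    have half': "(\<Sum>x\<in>V. \<Sum>y\<in>V. w x y * (indicator (V - S) x * indicator S y)) = (\<Sum>x\<in>S. \<Sum>y\<in>V - S. w x y)"
      unfolding half[symmetric] by (subst sum.swap) (simp add: sym mult_ac)
    have "(\<Sum>x\<in>V. \<Sum>y\<in>V. w x y * c x y) = 2 * (\<Sum>x\<in>S. \<Sum>y\<in>V - S. w x y)"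
      using half half' by (simp add: c_def distrib_left sum.distrib)
    moreover have "(\<Sum>x\<in>V. \<Sum>y\<in>V. w x y * \<bar>g x - g y\<bar>)
        = (\<Sum>x\<in>V. \<Sum>y\<in>V. w x y * \<bar>g' x - g' y\<bar>) + m * (\<Sum>x\<in>V. \<Sum>y\<in>V. w x y * c x y)"
      by (simp add: split sum.distrib sum_distrib_left)
    moreover have "m * (h * real (card S)) \<le> m * (\<Sum>x\<in>S. \<Sum>y\<in>V - S. w x y)"
      using iso[OF S(2)] less.prems(2) m0 by (simp add: S_def)
    ultimately show ?thesis using IH by (simp add: sumg algebra_simps)
  qed
qed

lemma sum_sym_weight_mult_degree:
  fixes w :: "'a \<Rightarrow> 'a \<Rightarrow> real"
  assumes sym: "\<And>x y. w x y = w y x"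
  shows "(\<Sum>x\<in>V. \<Sum>y\<in>V. w x y * f x) = (\<Sum>x\<in>V. (\<Sum>y\<in>V. w x y) * f x)"
    and "(\<Sum>x\<in>V. \<Sum>y\<in>V. w x y * f y) = (\<Sum>x\<in>V. (\<Sum>y\<in>V. w x y) * f x)"
proof -
  show *: "(\<Sum>x\<in>V. \<Sum>y\<in>V. w x y * f x) = (\<Sum>x\<in>V. (\<Sum>y\<in>V. w x y) * f x)"
    by (simp add: sum_distrib_right)
  show "(\<Sum>x\<in>V. \<Sum>y\<in>V. w x y * f y) = (\<Sum>x\<in>V. (\<Sum>y\<in>V. w x y) * f x)"
    unfolding *[symmetric] by (subst sum.swap) (simp add: sym)
qed

lemma sum_weighted_le:
  fixes w :: "'a \<Rightarrow> 'a \<Rightarrow> real"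
  assumes "\<And>x y. x \<in> V \<Longrightarrow> y \<in> V \<Longrightarrow> 0 \<le> w x y" and "\<And>x y. x \<in> V \<Longrightarrow> y \<in> V \<Longrightarrow> p x y \<le> q x y"
  shows "(\<Sum>x\<in>V. \<Sum>y\<in>V. w x y * p x y) \<le> (\<Sum>x\<in>V. \<Sum>y\<in>V. w x y * q x y)"
  by (intro sum_mono mult_left_mono assms)

lemma weighted_Cauchy_Schwarz:
  fixes w :: "'a \<Rightarrow> 'a \<Rightarrow> real"
  assumes "\<And>x y. 0 \<le> w x y"
  shows "(\<Sum>x\<in>V. \<Sum>y\<in>V. w x y * (p x y * q x y))\<^sup>2
    \<le> (\<Sum>x\<in>V. \<Sum>y\<in>V. w x y * (p x y)\<^sup>2) * (\<Sum>x\<in>V. \<Sum>y\<in>V. w x y * (q x y)\<^sup>2)"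
proof -
  have "(\<Sum>(x,y)\<in>V\<times>V. (sqrt (w x y) * p x y) * (sqrt (w x y) * q x y))\<^sup>2
    \<le> (\<Sum>(x,y)\<in>V\<times>V. (sqrt (w x y) * p x y)\<^sup>2) * (\<Sum>(x,y)\<in>V\<times>V. (sqrt (w x y) * q x y)\<^sup>2)"
    using Cauchy_Schwarz_ineq_sum[of "\<lambda>(x,y). sqrt (w x y) * p x y" "\<lambda>(x,y). sqrt (w x y) * q x y" "V \<times> V"]
    by (simp add: case_prod_beta)
  moreover have "sqrt (w x y) * p x y * (sqrt (w x y) * q x y) = w x y * (p x y * q x y)" for x y
    using assms[of x y] by (simp add: mult_ac) 
  ultimately show ?thesis
    using assms by (simp add: power_mult_distrib sum.cartesian_product)
qed

text \<open>The coarea inequality is applied to the square of \<open>g\<close>, whose difference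
  factors as (g x - g y)(g x + g y). Cauchy-Schwarz separates the factors: the first gives the
  Dirichlet energy, the second at most 4 D times the sum of squares \<open>T\<close>. One factor
  \<open>T\<close> then cancels.\<close>

lemma Cheeger_inequality_supported:
  fixes w :: "'a \<Rightarrow> 'a \<Rightarrow> real" and g :: "'a \<Rightarrow> real"
  assumes V: "finite V"
    and sym: "\<And>x y. w x y = w y x"
    and nn: "\<And>x y. 0 \<le> w x y"
    and iso: "\<And>S. S \<subseteq> V \<Longrightarrow> 2 * card S \<le> card V \<Longrightarrow> h * real (card S) \<le> (\<Sum>x\<in>S. \<Sum>y\<in>V - S. w x y)"
    and h: "0 \<le> h" and D: "0 \<le> D"
    and deg: "\<And>x. x \<in> V \<Longrightarrow> (\<Sum>y\<in>V. w x y) \<le> D"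
    and supp: "2 * card {x\<in>V. g x \<noteq> 0} \<le> card V"
  shows "h\<^sup>2 * (\<Sum>x\<in>V. (g x)\<^sup>2) \<le> D * (\<Sum>x\<in>V. \<Sum>y\<in>V. w x y * (g x - g y)\<^sup>2)"
proof -
  define T where "T = (\<Sum>x\<in>V. (g x)\<^sup>2)"
  define Y where "Y = (\<Sum>x\<in>V. \<Sum>y\<in>V. w x y * (g x - g y)\<^sup>2)"
  have T0: "0 \<le> T" by (simp add: T_def sum_nonneg)
  have Y0: "0 \<le> Y" using nn by (simp add: Y_def sum_nonneg)
  have "2 * h * T \<le> (\<Sum>x\<in>V. \<Sum>y\<in>V. w x y * \<bar>(g x)\<^sup>2 - (g y)\<^sup>2\<bar>)"
    unfolding T_def by (rule coarea_inequality[OF V sym iso]) (use supp in auto)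
  also have "\<dots> = (\<Sum>x\<in>V. \<Sum>y\<in>V. w x y * (\<bar>g x - g y\<bar> * \<bar>g x + g y\<bar>))"
    by (simp add: power2_eq_square square_diff_square_factored abs_mult mult_ac)
  finally have "(2 * h * T)\<^sup>2 \<le> (\<Sum>x\<in>V. \<Sum>y\<in>V. w x y * (\<bar>g x - g y\<bar> * \<bar>g x + g y\<bar>))\<^sup>2"
    using h T0 by (intro power_mono) auto
  also have "\<dots> \<le> Y * (\<Sum>x\<in>V. \<Sum>y\<in>V. w x y * (g x + g y)\<^sup>2)"
    using weighted_Cauchy_Schwarz[of w "\<lambda>x y. \<bar>g x - g y\<bar>" "\<lambda>x y. \<bar>g x + g y\<bar>" V] nn
    by (simp add: Y_def)
  also have "\<dots> \<le> Y * (4 * D * T)"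
  proof (intro mult_left_mono Y0)
    have "(g x + g y)\<^sup>2 \<le> 2 * (g x)\<^sup>2 + 2 * (g y)\<^sup>2" for x y
      using zero_le_power2[of "g x - g y"] by (simp add: power2_sum power2_diff)
    then have "(\<Sum>x\<in>V. \<Sum>y\<in>V. w x y * (g x + g y)\<^sup>2) \<le> (\<Sum>x\<in>V. \<Sum>y\<in>V. w x y * (2 * (g x)\<^sup>2 + 2 * (g y)\<^sup>2))"
      by (intro sum_weighted_le nn)
    also have "\<dots> = 4 * (\<Sum>x\<in>V. (\<Sum>y\<in>V. w x y) * (g x)\<^sup>2)"
      using sum_sym_weight_mult_degree[of w "\<lambda>x. 2 * (g x)\<^sup>2" V, OF sym]
      by (simp add: distrib_left sum.distrib) (simp add: mult.left_commute[of _ 2] flip: sum_distrib_left)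
    also have "\<dots> \<le> 4 * (\<Sum>x\<in>V. D * (g x)\<^sup>2)"
      by (intro mult_left_mono sum_mono mult_right_mono deg) auto
    finally show "(\<Sum>x\<in>V. \<Sum>y\<in>V. w x y * (g x + g y)\<^sup>2) \<le> 4 * D * T"
      by (simp add: T_def sum_distrib_left[symmetric] mult_ac)
  qed
  finally have *: "T * (h\<^sup>2 * T) \<le> T * (D * Y)"
    by (simp add: power_mult_distrib power2_eq_square mult_ac)
  show ?thesis
  proof (cases "T = 0")
    case True
    then show ?thesis using True D Y0 by (simp add: T_def[symmetric] Y_def[symmetric])
  next
    case False
    then show ?thesis using * T0 by (simp add: T_def[symmetric] Y_def[symmetric])
  qed
qed

text \<open>Take the smallest value \<open>m\<close> of \<open>f\<close> with at most half of
  \<open>V\<close> strictly above it. The next smaller value \<open>t\<close>, if any, fails this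
  test, so more than half of \<open>V\<close> lies above \<open>t\<close>, and those points are
  disjoint from the points below \<open>m\<close>.\<close>

lemma median_exists:
  fixes f :: "'a \<Rightarrow> real"
  assumes V: "finite V"
  shows "\<exists>m. 2 * card {x\<in>V. m < f x} \<le> card V \<and> 2 * card {x\<in>V. f x < m} \<le> card V"
proof (cases "V = {}")
  case False
  define C where "C = {t \<in> f ` V. 2 * card {x\<in>V. t < f x} \<le> card V}"
  have "{x\<in>V. Max (f ` V) < f x} = {}" using V by (auto simp: not_less)
  then have "2 * card {x\<in>V. Max (f ` V) < f x} \<le> card V" by (simp only: card.empty)
  then have "Max (f ` V) \<in> C" using V False Max_in[of "f ` V"] unfolding C_def by blast
  moreover have fC: "finite C" using V by (simp add: C_def)
  ultimately have mC: "Min C \<in> C" using Min_in by blast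
  define m where "m = Min C"
  have "2 * card {x\<in>V. f x < m} \<le> card V"
  proof (cases "{x\<in>V. f x < m} = {}")
    case ne: False
    define t where "t = Max (f ` {x\<in>V. f x < m})"
    have le_t: "f x \<le> t" if "x \<in> V" "f x < m" for x
      using V that by (simp add: t_def)
    have "t \<in> f ` {x\<in>V. f x < m}" using ne V by (simp add: t_def)
    then have t: "t \<in> f ` V" "t < m" by auto
    have "t \<notin> C" using t(2) Min_le[OF fC, of t] unfolding m_def by linarith
    then have "card V < 2 * card {x\<in>V. t < f x}" using t by (simp add: C_def)
    moreover have "{x\<in>V. t < f x} \<inter> {x\<in>V. f x < m} = {}"
      using le_t by force
    then have "card {x\<in>V. t < f x} + card {x\<in>V. f x < m} \<le> card V"
      using V by (subst card_Un_disjoint[symmetric]) (auto intro!: card_mono)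
    ultimately show ?thesis by simp
  qed (metis card.empty mult_zero_right zero_le)
  then show ?thesis using mC by (auto simp: C_def m_def)
qed auto

text \<open>Centring at a median rather than the mean makes the positive part \<open>p\<close> and
  the negative part \<open>q\<close> of f - m each supported on at most half of \<open>V\<close>, as
  the supported Cheeger inequality demands.\<close>

lemma Poincare_inequality_median:
  fixes w :: "'a \<Rightarrow> 'a \<Rightarrow> real" and f :: "'a \<Rightarrow> real"
  assumes V: "finite V"
    and sym: "\<And>x y. w x y = w y x"
    and nn: "\<And>x y. 0 \<le> w x y"
    and iso: "\<And>S. S \<subseteq> V \<Longrightarrow> 2 * card S \<le> card V \<Longrightarrow> h * real (card S) \<le> (\<Sum>x\<in>S. \<Sum>y\<in>V - S. w x y)"
    and h: "0 \<le> h" and D: "0 \<le> D"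
    and deg: "\<And>x. x \<in> V \<Longrightarrow> (\<Sum>y\<in>V. w x y) \<le> D"
  shows "\<exists>m. h\<^sup>2 * (\<Sum>x\<in>V. (f x - m)\<^sup>2) \<le> D * (\<Sum>x\<in>V. \<Sum>y\<in>V. w x y * (f x - f y)\<^sup>2)"
proof -
  obtain m where m: "2 * card {x\<in>V. m < f x} \<le> card V" "2 * card {x\<in>V. f x < m} \<le> card V"
    using median_exists[OF V] by blast
  define p where "p x = max (f x - m) 0" for x
  define q where "q x = max (m - f x) 0" for x
  have "{x\<in>V. p x \<noteq> 0} = {x\<in>V. m < f x}" "{x\<in>V. q x \<noteq> 0} = {x\<in>V. f x < m}"
    by (auto simp: p_def q_def max_def)
  then have P: "h\<^sup>2 * (\<Sum>x\<in>V. (p x)\<^sup>2) \<le> D * (\<Sum>x\<in>V. \<Sum>y\<in>V. w x y * (p x - p y)\<^sup>2)"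
    and Q: "h\<^sup>2 * (\<Sum>x\<in>V. (q x)\<^sup>2) \<le> D * (\<Sum>x\<in>V. \<Sum>y\<in>V. w x y * (q x - q y)\<^sup>2)"
    using m by (auto intro!: Cheeger_inequality_supported[OF V sym nn iso h D deg])
  have sq: "(f x - m)\<^sup>2 = (p x)\<^sup>2 + (q x)\<^sup>2" for x
    by (auto simp: p_def q_def max_def power2_eq_square algebra_simps)
  \<comment> \<open>\<open>p\<close> and \<open>q\<close> never are positive at the same point, so
    their increments have opposite signs and the energies of the two parts add up to at most that of
    \<open>f\<close>.\<close>
  have cross: "(p x - p y)\<^sup>2 + (q x - q y)\<^sup>2 \<le> (f x - f y)\<^sup>2" for x y
  proof -
    have fp: "f x - f y = (p x - p y) - (q x - q y)" by (auto simp: p_def q_def)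
    have "p x * q x = 0" "p y * q y = 0" "0 \<le> p x * q y" "0 \<le> p y * q x"
      by (auto simp: p_def q_def max_def)
    then have "(p x - p y) * (q x - q y) \<le> 0" by (simp only: algebra_simps)
    then show ?thesis unfolding fp power2_diff[of "p x - p y" "q x - q y"] by linarith
  qed
  have "h\<^sup>2 * (\<Sum>x\<in>V. (f x - m)\<^sup>2) \<le> D * (\<Sum>x\<in>V. \<Sum>y\<in>V. w x y * ((p x - p y)\<^sup>2 + (q x - q y)\<^sup>2))"
    using P Q by (simp add: sq sum.distrib distrib_left)
  also have "\<dots> \<le> D * (\<Sum>x\<in>V. \<Sum>y\<in>V. w x y * (f x - f y)\<^sup>2)"
    using D by (auto intro!: mult_left_mono sum_weighted_le nn cross)
  finally show ?thesis by blast
qed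

section \<open>Killed lazy random walks\<close>

text \<open>\<open>b\<close> is the killed part of the weight \<open>w\<close>. The function \<open>f\<close> either deviates from its median \<open>m\<close>,
  which costs Dirichlet energy, or is close to \<open>m\<close> on most of the killed weight, which costs about
  \<open>M m\<^sup>2\<close>. The killed edges contribute at most \<open>4 R\<close> to the full Dirichlet energy, so it may
  be used in place of the energy of \<open>w - b\<close>.\<close>

lemma killed_Dirichlet_form_ge:
  fixes w b :: "'a \<Rightarrow> 'a \<Rightarrow> real" and f :: "'a \<Rightarrow> real"
  assumes V: "finite V"
    and sym: "\<And>x y. w x y = w y x" "\<And>x y. b x y = b y x"
    and nn: "\<And>x y. 0 \<le> b x y" "\<And>x y. b x y \<le> w x y"
    and iso: "\<And>S. S \<subseteq> V \<Longrightarrow> 2 * card S \<le> card V \<Longrightarrow> \<Delta> / 4 * real (card S) \<le> (\<Sum>x\<in>S. \<Sum>y\<in>V - S. w x y)"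
    and \<Delta>: "0 < \<Delta>"
    and deg: "\<And>x. x \<in> V \<Longrightarrow> (\<Sum>y\<in>V. w x y) \<le> 4 / 3 * \<Delta>"
  defines "M \<equiv> \<Sum>x\<in>V. \<Sum>y\<in>V. b x y"
  shows "M * (\<Sum>x\<in>V. (\<Sum>y\<in>V. w x y) * (f x)\<^sup>2) \<le> 1000 * real (card V) * \<Delta> *
    ((\<Sum>x\<in>V. (\<Sum>y\<in>V. w x y) * (f x)\<^sup>2) - (\<Sum>x\<in>V. \<Sum>y\<in>V. (w x y - b x y) * (f x * f y)))"
proof -
  define n where "n = real (card V)"
  define Edir where "Edir = (\<Sum>x\<in>V. \<Sum>y\<in>V. w x y * (f x - f y)\<^sup>2)"
  define Eb where "Eb = (\<Sum>x\<in>V. \<Sum>y\<in>V. b x y * (f x - f y)\<^sup>2)"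
  define db where "db x = (\<Sum>y\<in>V. b x y)" for x
  define R where "R = (\<Sum>x\<in>V. db x * (f x)\<^sup>2)"
  define X where "X = (\<Sum>x\<in>V. (\<Sum>y\<in>V. w x y) * (f x)\<^sup>2) - (\<Sum>x\<in>V. \<Sum>y\<in>V. (w x y - b x y) * (f x * f y))"
  have wnn: "0 \<le> w x y" for x y using nn order_trans by blast
  have db: "0 \<le> db x" "x \<in> V \<Longrightarrow> db x \<le> 4 / 3 * \<Delta>" for x
    using nn order_trans[OF sum_mono[of V "b x" "w x"] deg[of x]] by (auto simp: db_def sum_nonneg)
  have R0: "0 \<le> R" by (simp add: R_def sum_nonneg db)
  have n0: "0 \<le> n" by (simp add: n_def)
  have expand: "(\<Sum>x\<in>V. \<Sum>y\<in>V. u x y * (f x - f y)\<^sup>2)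
     = 2 * (\<Sum>x\<in>V. (\<Sum>y\<in>V. u x y) * (f x)\<^sup>2) - 2 * (\<Sum>x\<in>V. \<Sum>y\<in>V. u x y * (f x * f y))"
    if "\<And>x y. u x y = u y x" for u :: "'a \<Rightarrow> 'a \<Rightarrow> real"
    using sum_sym_weight_mult_degree[of u "\<lambda>x. (f x)\<^sup>2" V, OF that]
    by (simp add: power2_diff algebra_simps sum.distrib sum_subtractf sum_distrib_left)
  \<comment> \<open>The form of the killed operator is half the ordered-pair energy of the surviving
    edges plus the potential \<open>R\<close>, the mass of f^2 lost by killing.\<close>
  have Xeq: "X = (Edir - Eb) / 2 + R"
    using expand[of w, OF sym(1)] expand[of b, OF sym(2)]
    by (simp add: X_def Edir_def Eb_def R_def db_def left_diff_distrib sum_subtractf diff_divide_distrib)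
  have "(f x - f y)\<^sup>2 \<le> 2 * (f x)\<^sup>2 + 2 * (f y)\<^sup>2" for x y
    using zero_le_power2[of "f x + f y"] by (simp add: power2_diff power2_sum)
  then have "Eb \<le> (\<Sum>x\<in>V. \<Sum>y\<in>V. b x y * (2 * (f x)\<^sup>2 + 2 * (f y)\<^sup>2))"
    unfolding Eb_def
    by (intro sum_weighted_le nn)
  also have "\<dots> = 4 * R"
    using sum_sym_weight_mult_degree[of b "\<lambda>x. (f x)\<^sup>2" V, OF sym(2)]
    by (simp add: R_def db_def algebra_simps sum.distrib flip: sum_distrib_left)
  finally have Eb: "Eb \<le> 4 * R" .
  have EbE: "Eb \<le> Edir"
    unfolding Eb_def Edir_def by (intro sum_mono mult_right_mono nn) auto
  \<comment> \<open>Edir = 2 X + Eb - 2 R is at most 2 X + 2 R, and R is at most X because the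
    surviving energy Edir - Eb is nonnegative.\<close>
  have "2 * X = Edir - Eb + 2 * R" using Xeq by simp
  then have E4: "Edir \<le> 4 * X" and R1: "R \<le> X" and X0: "0 \<le> X" using Eb EbE R0 by linarith+
  obtain m where m: "(\<Delta> / 4)\<^sup>2 * (\<Sum>x\<in>V. (f x - m)\<^sup>2) \<le> 4 / 3 * \<Delta> * Edir"
    using Poincare_inequality_median[of V w "\<Delta> / 4" "4 / 3 * \<Delta>" f, OF V sym(1) wnn iso _ _ deg] \<Delta>
    unfolding Edir_def by fastforce
  define K where "K = (\<Sum>x\<in>V. (f x - m)\<^sup>2)"
  have K0: "0 \<le> K" by (simp add: K_def sum_nonneg)
  have "\<Delta> * (3 * \<Delta> * K) \<le> \<Delta> * (64 * Edir)"
    using m[folded K_def] by (simp add: power2_eq_square[of \<Delta>] field_simps)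
  then have "3 * \<Delta> * K \<le> 64 * Edir" using \<Delta> by simp
  then have K: "3 * \<Delta> * K \<le> 256 * X" using E4 by simp
  have pt: "m\<^sup>2 \<le> 2 * (f x)\<^sup>2 + 2 * (f x - m)\<^sup>2" for x
    using zero_le_power2[of "2 * f x - m"] by (simp add: power2_eq_square algebra_simps)
  have "M * m\<^sup>2 = (\<Sum>x\<in>V. db x * m\<^sup>2)" by (simp add: M_def db_def sum_distrib_right)
  also have "\<dots> \<le> (\<Sum>x\<in>V. db x * (2 * (f x)\<^sup>2 + 2 * (f x - m)\<^sup>2))"
    by (intro sum_mono mult_left_mono pt db)
  also have "\<dots> = 2 * R + 2 * (\<Sum>x\<in>V. db x * (f x - m)\<^sup>2)"
    by (simp add: R_def algebra_simps sum.distrib sum_distrib_left)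
  also have "(\<Sum>x\<in>V. db x * (f x - m)\<^sup>2) \<le> 4 / 3 * \<Delta> * K"
    unfolding K_def sum_distrib_left by (intro sum_mono mult_right_mono db) auto
  \<comment> \<open>The constant is 2 + (8/9) * 256 < 230, from \<open>R \<le> X\<close> and the
    bound on \<open>3 * \<Delta> * K\<close>.\<close>
  finally have Mm: "M * m\<^sup>2 \<le> 230 * X" using K R1 X0 by simp
  have pt': "(f x)\<^sup>2 \<le> 2 * m\<^sup>2 + 2 * (f x - m)\<^sup>2" for x
    using zero_le_power2[of "f x - 2 * m"] by (simp add: power2_eq_square algebra_simps)
  have "(\<Sum>x\<in>V. (f x)\<^sup>2) \<le> (\<Sum>x\<in>V. 2 * m\<^sup>2 + 2 * (f x - m)\<^sup>2)" by (intro sum_mono pt')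
  also have "\<dots> = 2 * n * m\<^sup>2 + 2 * K" by (simp add: K_def n_def sum.distrib sum_distrib_left)
  finally have F: "(\<Sum>x\<in>V. (f x)\<^sup>2) \<le> 2 * n * m\<^sup>2 + 2 * K" .
  have M0: "0 \<le> M" by (simp add: M_def sum_nonneg nn)
  have "M \<le> (\<Sum>x\<in>V. 4 / 3 * \<Delta>)" using db(2) unfolding M_def db_def by (intro sum_mono) auto
  then have Mle: "M \<le> 4 / 3 * \<Delta> * n" by (simp add: n_def mult_ac)
  \<comment> \<open>For the deviation from \<open>m\<close> the crude bound of \<open>M\<close> by
    the total weight suffices, since \<open>K\<close> is already small: (4/9) * 256 < 114. Below, 2
    * 230 + 2 * 114 < 700 and (4/3) * 700 < 1000.\<close>
  have "M * K \<le> 4 / 3 * \<Delta> * n * K" by (intro mult_right_mono Mle K0)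
  also have "\<dots> \<le> 114 * n * X"
    using mult_left_mono[OF K, of "4 / 9 * n"] n0 mult_nonneg_nonneg[OF n0 X0] by (simp add: algebra_simps)
  finally have MK: "M * K \<le> 114 * n * X" .
  have "M * (\<Sum>x\<in>V. (f x)\<^sup>2) \<le> M * (2 * n * m\<^sup>2 + 2 * K)" by (intro mult_left_mono F M0)
  also have "\<dots> \<le> 700 * n * X"
    using MK mult_left_mono[OF Mm, of "2 * n"] n0 mult_nonneg_nonneg[OF n0 X0] by (simp add: algebra_simps)
  finally have MF: "M * (\<Sum>x\<in>V. (f x)\<^sup>2) \<le> 700 * n * X" .
  have "M * (\<Sum>x\<in>V. (\<Sum>y\<in>V. w x y) * (f x)\<^sup>2) \<le> M * (\<Sum>x\<in>V. 4 / 3 * \<Delta> * (f x)\<^sup>2)"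
    by (intro mult_left_mono M0 sum_mono mult_right_mono deg) auto
  also have "\<dots> = 4 / 3 * \<Delta> * (M * (\<Sum>x\<in>V. (f x)\<^sup>2))" by (simp add: sum_distrib_left mult_ac)
  also have "\<dots> \<le> 4 / 3 * \<Delta> * (700 * n * X)" using \<Delta> by (intro mult_left_mono MF) auto
  also have "\<dots> \<le> 1000 * n * \<Delta> * X"
    using mult_nonneg_nonneg[OF n0 X0] mult_nonneg_nonneg[OF less_imp_le[OF \<Delta>], of "n * X"] by (simp add: algebra_simps)
  finally show ?thesis by (simp add: n_def X_def)
qed

text \<open>With \<open>T\<close> the killed adjacency operator, the new squared norm is a quarter
  of \<Phi> + 2 <f, T f> plus the squared norm of T f / d. The gap bounds the inner product by (1 -
  \<delta>) \<Phi>, and the last term is at most \<Phi>. Because of laziness, no bound on the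
  negative part of the spectrum is involved.\<close>

lemma lazy_killed_step_contraction:
  fixes w b :: "'a \<Rightarrow> 'a \<Rightarrow> real" and f :: "'a \<Rightarrow> real"
  assumes V: "finite V"
    and sym: "\<And>x y. w x y = w y x" "\<And>x y. b x y = b y x"
    and nn: "\<And>x y. 0 \<le> b x y" "\<And>x y. b x y \<le> w x y"
    and pos: "\<And>x. x \<in> V \<Longrightarrow> 0 < (\<Sum>y\<in>V. w x y)"
    and gap: "\<delta> * (\<Sum>x\<in>V. (\<Sum>y\<in>V. w x y) * (f x)\<^sup>2) \<le>
      (\<Sum>x\<in>V. (\<Sum>y\<in>V. w x y) * (f x)\<^sup>2) - (\<Sum>x\<in>V. \<Sum>y\<in>V. (w x y - b x y) * (f x * f y))"
  shows "(\<Sum>x\<in>V. (\<Sum>y\<in>V. w x y) * ((f x + (\<Sum>y\<in>V. (w x y - b x y) * f y) / (\<Sum>y\<in>V. w x y)) / 2)\<^sup>2)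
    \<le> (1 - \<delta> / 2) * (\<Sum>x\<in>V. (\<Sum>y\<in>V. w x y) * (f x)\<^sup>2)"
proof -
  define d where "d x = (\<Sum>y\<in>V. w x y)" for x
  define T where "T x = (\<Sum>y\<in>V. (w x y - b x y) * f y)" for x
  define \<Phi> where "\<Phi> = (\<Sum>x\<in>V. d x * (f x)\<^sup>2)"
  have wnn: "0 \<le> w x y" for x y using nn order_trans by blast
  \<comment> \<open>Cauchy-Schwarz in row \<open>x\<close>, after which the killed weight is put
    back. Summed over \<open>x\<close>, the symmetry of \<open>w\<close> turns the right side into
    \<Phi>.\<close>
  have T2: "(T x)\<^sup>2 / d x \<le> (\<Sum>y\<in>V. w x y * (f y)\<^sup>2)" if x: "x \<in> V" for x
  proof -
    have "(T x)\<^sup>2 = (\<Sum>y\<in>V. sqrt (w x y - b x y) * (sqrt (w x y - b x y) * f y))\<^sup>2"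
      using nn by (simp add: T_def mult.assoc[symmetric])
    also have "\<dots> \<le> (\<Sum>y\<in>V. (sqrt (w x y - b x y))\<^sup>2) * (\<Sum>y\<in>V. (sqrt (w x y - b x y) * f y)\<^sup>2)"
      by (rule Cauchy_Schwarz_ineq_sum)
    also have "\<dots> = (\<Sum>y\<in>V. w x y - b x y) * (\<Sum>y\<in>V. (w x y - b x y) * (f y)\<^sup>2)"
      using nn by (simp add: power_mult_distrib)
    also have "\<dots> \<le> d x * (\<Sum>y\<in>V. w x y * (f y)\<^sup>2)"
      unfolding d_def using nn wnn
      by (intro mult_mono sum_mono mult_right_mono sum_nonneg) auto
    finally show ?thesis using pos[OF x] by (simp add: d_def divide_le_eq mult.commute)
  qed
  have "(\<Sum>x\<in>V. (T x)\<^sup>2 / d x) \<le> (\<Sum>x\<in>V. \<Sum>y\<in>V. w x y * (f y)\<^sup>2)" by (intro sum_mono T2)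
  then have TT: "(\<Sum>x\<in>V. (T x)\<^sup>2 / d x) \<le> \<Phi>"
    using sum_sym_weight_mult_degree(2)[of w "\<lambda>x. (f x)\<^sup>2" V, OF sym(1)] by (simp add: \<Phi>_def d_def)
  have fT: "(\<Sum>x\<in>V. f x * T x) \<le> \<Phi> - \<delta> * \<Phi>"
    using gap by (simp add: \<Phi>_def d_def T_def sum_distrib_left mult_ac)
  have "d x * ((f x + T x / d x) / 2)\<^sup>2 = (d x * (f x)\<^sup>2 + 2 * (f x * T x) + (T x)\<^sup>2 / d x) / 4" if "x \<in> V" for x
    using pos[OF that] by (simp add: d_def[symmetric] power2_eq_square field_simps)
  then have "(\<Sum>x\<in>V. d x * ((f x + T x / d x) / 2)\<^sup>2)
      = (\<Sum>x\<in>V. (d x * (f x)\<^sup>2 + 2 * (f x * T x) + (T x)\<^sup>2 / d x) / 4)"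
    by (intro sum.cong refl)
  also have "\<dots> = (\<Phi> + 2 * (\<Sum>x\<in>V. f x * T x) + (\<Sum>x\<in>V. (T x)\<^sup>2 / d x)) / 4"
    by (simp add: \<Phi>_def sum.distrib sum_distrib_left flip: sum_divide_distrib)
  also have "\<dots> \<le> (\<Phi> + 2 * (\<Phi> - \<delta> * \<Phi>) + \<Phi>) / 4" using TT fT by simp
  also have "\<dots> = (1 - \<delta> / 2) * \<Phi>" by (simp add: field_simps)
  finally show ?thesis by (simp add: \<Phi>_def d_def T_def)
qed

section \<open>The lazy walk on a graph\<close>

lemma measure_bind_pmf:
  "measure_pmf.prob (bind_pmf M f) X = (\<integral>x. measure_pmf.prob (f x) X \<partial>measure_pmf M)"
proof -
  have *: "measure_pmf.prob p X = pmf (map_pmf (\<lambda>x. x \<in> X) p) True" for p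
    by (simp add: pmf_map vimage_def)
  show ?thesis by (simp add: * map_bind_pmf pmf_bind)
qed

text \<open>The pairs (x, x) produced by lazy steps are tested as well, so \<open>bad\<close> is
  taken to be irreflexive where the walk is analysed.\<close>

definition avoids :: "('a \<Rightarrow> 'a \<Rightarrow> bool) \<Rightarrow> 'a list \<Rightarrow> bool" where
  "avoids bad xs \<longleftrightarrow> (\<forall>(x, y) \<in> set (zip xs (tl xs)). \<not> bad x y)"

lemma avoids_single [simp]: "avoids bad [x]"
  and avoids_Cons_Cons [simp]: "avoids bad (x # y # zs) \<longleftrightarrow> \<not> bad x y \<and> avoids bad (y # zs)"
  by (auto simp: avoids_def)

lemma set_pmf_lazy_walk_Cons: "xs \<in> set_pmf (lazy_walk E v L) \<Longrightarrow> \<exists>ys. xs = v # ys"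
  by (cases L) auto

text \<open>Conditioning on the first step: every list in the support of the walk from
  \<open>y\<close> begins with \<open>y\<close>, so prepending \<open>v\<close> adds just the test
  of the pair (v, y). The result is the lazy killed transition operator applied to
  \<open>u L\<close>.\<close>

lemma prob_lazy_walk_avoids_Suc:
  assumes fin: "finite (nbrs E v)" and ne: "nbrs E v \<noteq> {}" and irr: "\<not> bad v v"
  defines "u \<equiv> \<lambda>L x. measure_pmf.prob (lazy_walk E x L) {xs. avoids bad xs}"
  shows "u (Suc L) v = (u L v + (\<Sum>y\<in>nbrs E v. of_bool (\<not> bad v y) * u L y) / real (deg E v)) / 2"
proof -
  have step: "measure_pmf.prob (map_pmf ((#) v) (lazy_walk E y L)) {xs. avoids bad xs} = of_bool (\<not> bad v y) * u L y" for y
  proof -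
    have "{xs. avoids bad (v # xs)} \<inter> set_pmf (lazy_walk E y L)
        = (if bad v y then {} else {xs. avoids bad xs} \<inter> set_pmf (lazy_walk E y L))"
      by (auto dest: set_pmf_lazy_walk_Cons)
    then show ?thesis
      using measure_Int_set_pmf[of "lazy_walk E y L" "{xs. avoids bad (v # xs)}"]
        measure_Int_set_pmf[of "lazy_walk E y L" "{xs. avoids bad xs}"]
      by (auto simp: u_def vimage_def split: if_splits)
  qed
  have "u (Suc L) v = measure_pmf.prob (bind_pmf (bernoulli_pmf (1/2))
      (\<lambda>stay. bind_pmf (if stay then return_pmf v else pmf_of_set (nbrs E v))
        (\<lambda>y. map_pmf ((#) v) (lazy_walk E y L)))) {xs. avoids bad xs}"
    by (simp add: u_def lazy_step_def bind_assoc_pmf)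
  then show ?thesis
    by (simp add: measure_bind_pmf bind_return_pmf step irr integral_pmf_of_set[OF ne fin] deg_def
      add_divide_distrib del: measure_map_pmf)
qed

text \<open>Ordered pairs map onto the edges, but (x, y) and (y, x) give the same edge when both
  ends lie in both sets; hence only an inequality.\<close>

lemma card_edges_between_le:
  assumes "finite A" "finite B"
  shows "real (card (edges_between E A B)) \<le> (\<Sum>x\<in>A. \<Sum>y\<in>B. of_bool ({x, y} \<in> E))"
proof -
  define P where "P = (SIGMA x:A. {y\<in>B. {x, y} \<in> E})"
  have P: "finite P" unfolding P_def using assms by (intro finite_SigmaI) auto
  have "edges_between E A B \<subseteq> (\<lambda>(x, y). {x, y}) ` P"
    by (auto simp: edges_between_def P_def)
  then have "card (edges_between E A B) \<le> card P"
    using P by (meson card_image_le card_mono finite_imageI order_trans)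
  also have "card P = (\<Sum>x\<in>A. card {y\<in>B. {x, y} \<in> E})"
    unfolding P_def using assms by (intro card_SigmaI) auto
  finally have "real (card (edges_between E A B)) \<le> real (\<Sum>x\<in>A. card {y\<in>B. {x, y} \<in> E})"
    by (rule of_nat_mono)
  then show ?thesis
    using assms by (simp add: of_bool_def sum.If_cases Int_def)
qed

lemma nbrs_subset: "graph_on n E \<Longrightarrow> nbrs E v \<subseteq> {1..n}"
  unfolding graph_on_def nbrs_def by fastforce

lemma sum_nbrs:
  fixes f :: "nat \<Rightarrow> real"
  assumes "graph_on n E"
  shows "(\<Sum>y\<in>nbrs E v. f y) = (\<Sum>y\<in>{1..n}. of_bool ({v, y} \<in> E) * f y)"
  using nbrs_subset[OF assms, of v]
  by (intro sum.mono_neutral_cong_left) (auto simp: nbrs_def)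

lemma deg_eq_sum:
  assumes "graph_on n E"
  shows "real (deg E v) = (\<Sum>y\<in>{1..n}. of_bool ({v, y} \<in> E))"
  using sum_nbrs[OF assms, of "\<lambda>_. 1" v] by (simp add: deg_def)

text \<open>The complement of \<open>S\<close> has at least n / 2 vertices, so the factor |S^c| / (2
  n) in (P3) is at least 1/4. This is the isoperimetric hypothesis of the Cheeger section with
  \<Delta> = \<alpha> ln n.\<close>

lemma edge_expanding_half:
  assumes "edge_expanding n \<alpha> E" "0 < \<alpha> * ln (real n)" "S \<subseteq> {1..n}" "2 * card S \<le> n"
  shows "\<alpha> * ln (real n) / 4 * real (card S) \<le> (\<Sum>x\<in>S. \<Sum>y\<in>{1..n} - S. of_bool ({x, y} \<in> E))"
proof (cases "S = {}")
  case False
  have fS: "finite S" using assms(3) finite_subset by blast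
  then have "0 < card S" using False by (simp add: card_gt_0_iff)
  then have n: "0 < n" using assms(4) by simp
  have c: "real (card ({1..n} - S)) \<ge> real n / 2"
    using assms(3,4) fS by (simp add: card_Diff_subset of_nat_diff)
  have "\<alpha> * ln (real n) / 4 * real (card S) = real (card S) * (real n / 2) * (\<alpha> * ln (real n)) / (2 * real n)"
    using n by (simp add: field_simps)
  also have "\<dots> \<le> real (card S) * real (card ({1..n} - S)) * (\<alpha> * ln (real n)) / (2 * real n)"
    using c assms(2) by (intro divide_right_mono mult_right_mono mult_left_mono) auto
  also have "\<dots> \<le> real (card (edge_boundary n E S))"
    using assms(1)[unfolded edge_expanding_def, rule_format, OF assms(3) False] assms(4)
    by (simp add: mult.assoc)
  also have "\<dots> \<le> (\<Sum>x\<in>S. \<Sum>y\<in>{1..n} - S. of_bool ({x, y} \<in> E))"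
    unfolding edge_boundary_def using fS by (intro card_edges_between_le) auto
  finally show ?thesis .
qed simp

text \<open>The degree-weighted energy \<Phi> starts at no more than (4/3) D n, contracts at every
  step, and dominates its single term at \<open>v\<close>, whose weight is at least (5/6) D. The
  quotient of these weights is 8/5; the 2000 is the 1000 of the Dirichlet bound, doubled by
  laziness.\<close>

lemma prob_lazy_walk_avoids_le:
  fixes \<alpha> :: real
  assumes E: "graph_on n E" "degrees_ok n \<alpha> E" "edge_expanding n \<alpha> E"
    and \<Delta>: "0 < \<alpha> * ln (real n)"
    and bad: "\<And>x y. bad x y = bad y x" "\<And>x. \<not> bad x x"
    and M: "M \<le> (\<Sum>x\<in>{1..n}. \<Sum>y\<in>{1..n}. of_bool ({x, y} \<in> E \<and> bad x y))"
    and v: "v \<in> {1..n}"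
  shows "(measure_pmf.prob (lazy_walk E v L) {xs. avoids bad xs})\<^sup>2
    \<le> 8 / 5 * real n * exp (- (M * real L / (2000 * real n * (\<alpha> * ln (real n)))))"
proof -
  define V where "V = {1..n}"
  define D where "D = \<alpha> * ln (real n)"
  define w b :: "nat \<Rightarrow> nat \<Rightarrow> real" where "w x y = of_bool ({x, y} \<in> E)"
    and "b x y = of_bool ({x, y} \<in> E \<and> bad x y)" for x y
  define d where "d x = (\<Sum>y\<in>V. w x y)" for x
  define M' where "M' = (\<Sum>x\<in>V. \<Sum>y\<in>V. b x y)"
  define u where "u L x = measure_pmf.prob (lazy_walk E x L) {xs. avoids bad xs}" for L x
  define \<delta> where "\<delta> = M' / (1000 * real n * D)"
  define \<Phi> where "\<Phi> L = (\<Sum>x\<in>V. d x * (u L x)\<^sup>2)" for L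
  have n: "0 < n" using v by auto
  have D: "0 < D" using \<Delta> by (simp add: D_def)
  have V: "finite V" "card V = n" by (auto simp: V_def)
  have d_deg: "d x = real (deg E x)" for x
    by (simp add: d_def w_def V_def deg_eq_sum[OF E(1)])
  have d: "5 / 6 * D \<le> d x" "d x \<le> 4 / 3 * D" if "x \<in> V" for x
    using E(2) that by (auto simp: degrees_ok_def D_def V_def d_deg mult.assoc)
  have dpos: "0 < d x" if "x \<in> V" for x using d(1)[OF that] D by linarith
  have sym: "w x y = w y x" "b x y = b y x" for x y by (auto simp: w_def b_def insert_commute bad(1))
  have nn: "0 \<le> b x y" "b x y \<le> w x y" for x y by (auto simp: w_def b_def)
  have step: "u (Suc L) x = (u L x + (\<Sum>y\<in>V. (w x y - b x y) * u L y) / d x) / 2" if x: "x \<in> V" for L x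
  proof -
    have "finite (nbrs E x)" "nbrs E x \<noteq> {}"
      using nbrs_subset[OF E(1), of x] finite_subset dpos[OF x] by (auto simp: d_deg deg_def)
    then have "u (Suc L) x = (u L x + (\<Sum>y\<in>nbrs E x. of_bool (\<not> bad x y) * u L y) / real (deg E x)) / 2"
      unfolding u_def by (intro prob_lazy_walk_avoids_Suc bad)
    also have "(\<Sum>y\<in>nbrs E x. of_bool (\<not> bad x y) * u L y) = (\<Sum>y\<in>V. (w x y - b x y) * u L y)"
      unfolding sum_nbrs[OF E(1)] V_def by (intro sum.cong) (auto simp: w_def b_def)
    finally show ?thesis by (simp add: d_deg)
  qed
  have \<Phi>0: "0 \<le> \<Phi> L" for L unfolding \<Phi>_def
    by (intro sum_nonneg mult_nonneg_nonneg) (auto intro: less_imp_le[OF dpos])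
  have contract: "\<Phi> (Suc L) \<le> exp (- (\<delta> / 2)) * \<Phi> L" for L
  proof -
    have "M' * \<Phi> L \<le> 1000 * real (card V) * D *
       (\<Phi> L - (\<Sum>x\<in>V. \<Sum>y\<in>V. (w x y - b x y) * (u L x * u L y)))"
      unfolding M'_def \<Phi>_def d_def
    proof (rule killed_Dirichlet_form_ge[OF V(1) sym nn _ D])
      show "D / 4 * real (card S) \<le> (\<Sum>x\<in>S. \<Sum>y\<in>V - S. w x y)" if "S \<subseteq> V" "2 * card S \<le> card V" for S
        using edge_expanding_half[OF E(3) \<Delta>, of S] that by (simp add: V_def w_def D_def)
      show "(\<Sum>y\<in>V. w x y) \<le> 4 / 3 * D" if "x \<in> V" for x using d(2)[OF that] by (simp add: d_def)
    qed
    then have gap: "\<delta> * \<Phi> L \<le> \<Phi> L - (\<Sum>x\<in>V. \<Sum>y\<in>V. (w x y - b x y) * (u L x * u L y))"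
      using n D by (simp add: V \<delta>_def divide_le_eq mult_ac)
    have "\<Phi> (Suc L) = (\<Sum>x\<in>V. d x * ((u L x + (\<Sum>y\<in>V. (w x y - b x y) * u L y) / d x) / 2)\<^sup>2)"
      unfolding \<Phi>_def by (intro sum.cong refl) (simp add: step)
    also have "\<dots> \<le> (1 - \<delta> / 2) * \<Phi> L"
      using gap dpos unfolding \<Phi>_def d_def by (intro lazy_killed_step_contraction V sym nn)
    also have "\<dots> \<le> exp (- (\<delta> / 2)) * \<Phi> L"
      using exp_ge_add_one_self[of "- (\<delta> / 2)"] by (intro mult_right_mono \<Phi>0) auto
    finally show ?thesis .
  qed
  have decay: "\<Phi> L \<le> exp (- (\<delta> / 2 * real L)) * \<Phi> 0" for L
  proof (induction L)
    case (Suc L)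
    have "\<Phi> (Suc L) \<le> exp (- (\<delta> / 2)) * (exp (- (\<delta> / 2 * real L)) * \<Phi> 0)"
      by (intro order_trans[OF contract[of L]] mult_left_mono Suc) simp_all
    also have "\<dots> = exp (- (\<delta> / 2 * real (Suc L))) * \<Phi> 0"
      by (simp add: mult_exp_exp algebra_simps add_divide_distrib flip: mult.assoc)
    finally show ?case .
  qed simp
  have "\<Phi> 0 = (\<Sum>x\<in>V. d x)" by (simp add: \<Phi>_def u_def)
  also have "\<dots> \<le> (\<Sum>x\<in>V. 4 / 3 * D)" by (intro sum_mono d)
  finally have \<Phi>init: "\<Phi> 0 \<le> real n * (4 / 3 * D)" by (simp add: V)
  have vV: "v \<in> V" using v by (simp add: V_def)
  have "5 / 6 * D * (u L v)\<^sup>2 \<le> d v * (u L v)\<^sup>2" by (intro mult_right_mono d vV) auto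
  also have "\<dots> \<le> \<Phi> L"
    unfolding \<Phi>_def by (intro member_le_sum vV V mult_nonneg_nonneg less_imp_le[OF dpos]) auto
  also have "\<dots> \<le> exp (- (\<delta> / 2 * real L)) * (real n * (4 / 3 * D))"
    by (intro order_trans[OF decay] mult_left_mono \<Phi>init) simp
  finally have "D * (u L v)\<^sup>2 \<le> D * (8 / 5 * real n * exp (- (\<delta> / 2 * real L)))"
    by (simp add: mult_ac)
  then have "(u L v)\<^sup>2 \<le> 8 / 5 * real n * exp (- (\<delta> / 2 * real L))" using D by simp
  also have "\<dots> \<le> 8 / 5 * real n * exp (- (M * real L / (2000 * real n * D)))"
  proof -
    have "M * real L \<le> M' * real L" using M by (intro mult_right_mono) (auto simp: M'_def V_def b_def)
    then have "M * real L / (2000 * real n * D) \<le> M' * real L / (2000 * real n * D)"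
      using D by (intro divide_right_mono) auto
    also have "\<dots> = \<delta> / 2 * real L" by (simp add: \<delta>_def)
    finally show ?thesis by (intro mult_left_mono) auto
  qed
  finally show ?thesis by (simp add: u_def D_def)
qed

section \<open>Union bound over pairs of large sets\<close>

text \<open>Symmetric in \<open>x\<close> and \<open>y\<close>: the walk may traverse an edge in
  either direction, and the killed weight must be symmetric.\<close>

definition crosses :: "'a set \<Rightarrow> 'a set \<Rightarrow> 'a \<Rightarrow> 'a \<Rightarrow> bool" where
  "crosses A B x y \<longleftrightarrow> x \<in> A \<and> y \<in> B \<or> x \<in> B \<and> y \<in> A"

text \<open>By (P5) at least half of \<open>B\<close> lies outside the poorly joined set
  \<open>P\<close>, and each such vertex sends more than \<open>q\<close> edges to \<open>A\<close>.
  Only ordered pairs starting in \<open>B\<close> are counted, which is enough.\<close>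

lemma few_poorly_joined_imp_edges_between:
  assumes few: "few_poorly_joined n \<alpha> E" and \<alpha>: "0 \<le> \<alpha>"
    and AB: "A \<subseteq> {1..n}" "B \<subseteq> {1..n}" "A \<inter> B = {}"
    and card: "int (card A) = \<lceil>large_size n\<rceil>" "card B = card A"
  shows "real (card A) * \<alpha> * ln (ln (real n)) powr (3/2) / 4
    \<le> (\<Sum>x\<in>{1..n}. \<Sum>y\<in>{1..n}. of_bool ({x, y} \<in> E \<and> crosses A B x y))"
proof -
  define q where "q = \<alpha> * ln (ln (real n)) powr (3/2) / 2"
  define P where "P = {v \<in> {1..n} - A. real (card (edges_between E {v} A)) \<le> q}"
  have fin: "finite A" "finite B" "finite P" using AB by (auto simp: P_def intro: finite_subset)
  have "real (card P) \<le> real (card A) / 2"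
    using few AB(1) card(1) unfolding few_poorly_joined_def P_def q_def by blast
  moreover have "card B \<le> card (B - P) + card P"
    using fin by (intro order_trans[OF card_mono card_Un_le]) auto
  ultimately have "real (card A) / 2 \<le> real (card (B - P))" using card(2) by linarith
  then have "real (card A) / 2 * q \<le> real (card (B - P)) * q"
    using \<alpha> by (intro mult_right_mono) (auto simp: q_def)
  also have "\<dots> = (\<Sum>x\<in>B - P. q)" by simp
  also have "\<dots> \<le> (\<Sum>x\<in>B - P. \<Sum>y\<in>{1..n}. of_bool ({x, y} \<in> E \<and> crosses A B x y))"
  proof (rule sum_mono)
    fix x assume x: "x \<in> B - P"
    then have "q \<le> real (card (edges_between E {x} A))" using AB by (auto simp: P_def)
    also have "\<dots> \<le> (\<Sum>y\<in>A. of_bool ({x, y} \<in> E))"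
      using card_edges_between_le[of "{x}" A E] fin by simp
    also have "\<dots> = (\<Sum>y\<in>A. of_bool ({x, y} \<in> E \<and> crosses A B x y))"
      using x by (intro sum.cong) (auto simp: crosses_def)
    also have "\<dots> \<le> (\<Sum>y\<in>{1..n}. of_bool ({x, y} \<in> E \<and> crosses A B x y))"
      using AB by (intro sum_mono2) auto
    finally show "q \<le> (\<Sum>y\<in>{1..n}. of_bool ({x, y} \<in> E \<and> crosses A B x y))" .
  qed
  also have "\<dots> \<le> (\<Sum>x\<in>{1..n}. \<Sum>y\<in>{1..n}. of_bool ({x, y} \<in> E \<and> crosses A B x y))"
    using AB by (intro sum_mono2) (auto intro!: sum_nonneg)
  finally show ?thesis by (simp add: q_def mult_ac)
qed

text \<open>A weak Stirling bound: the left side over \<open>fact s\<close> is a single term of the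
  exponential series at \<open>s\<close>.\<close>

lemma power_le_fact_mult_exp: "real s ^ s \<le> fact s * exp (real s)"
proof -
  have "(\<Sum>k\<in>{s}. inverse (fact k) * real s ^ k) \<le> (\<Sum>k. inverse (fact k) * real s ^ k)"
    by (intro sum_le_suminf summable_exp) auto
  then have "inverse (fact s) * real s ^ s \<le> exp (real s)"
    by (simp add: exp_def)
  then show ?thesis by (simp add: field_simps)
qed

text \<open>The standard bound (e n / s)^s, with \<open>r\<close> in place of n / s.\<close>

lemma binomial_le_exp:
  assumes "0 < s" "real n \<le> real s * r" "0 < r"
  shows "real (n choose s) \<le> exp (real s * (1 + ln r))"
proof -
  have "real (n choose s) * real s ^ s \<le> real (n choose s) * (fact s * exp (real s))"
    by (intro mult_left_mono power_le_fact_mult_exp) auto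
  also have "\<dots> = real ((n choose s) * fact s) * exp (real s)" by simp
  also have "\<dots> \<le> real (n ^ s) * exp (real s)"
    by (intro mult_right_mono of_nat_mono binomial_fact_pow) auto
  also have "\<dots> \<le> (real s * r) ^ s * exp (real s)"
    using assms(2) by (auto intro!: mult_right_mono power_mono)
  also have "\<dots> = exp (real s * (1 + ln r)) * real s ^ s"
    using assms(3) by (simp add: power_mult_distrib distrib_left exp_add exp_of_nat_mult)
  finally show ?thesis using assms(1) by simp
qed

text \<open>Disjointness excludes x = y, so the offending step is not a lazy one and is recorded in
  the trace.\<close>

lemma not_avoids_crosses_imp_traversed:
  assumes "A \<inter> B = {}" "\<not> avoids (crosses A B) xs"
  shows "\<exists>a\<in>A. \<exists>b\<in>B. {a, b} \<in># traversed xs"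
proof -
  obtain x y where xy: "(x, y) \<in> set (zip xs (tl xs))" "crosses A B x y"
    using assms(2) by (auto simp: avoids_def)
  then have "x \<noteq> y" using assms(1) by (auto simp: crosses_def)
  then have "{x, y} \<in># traversed xs" using xy by (force simp: traversed_def)
  then show ?thesis using xy(2) unfolding crosses_def by (metis insert_commute)
qed

definition joins_large_sets :: "nat \<Rightarrow> nat set multiset \<Rightarrow> bool" where
  "joins_large_sets n \<Gamma> \<longleftrightarrow> (\<forall>A B. A \<subseteq> {1..n} \<longrightarrow> B \<subseteq> {1..n} \<longrightarrow> A \<inter> B = {} \<longrightarrow>
     real (card A) \<ge> large_size n \<longrightarrow> real (card B) \<ge> large_size n \<longrightarrow>
     (\<exists>a\<in>A. \<exists>b\<in>B. {a, b} \<in># \<Gamma>))"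

text \<open>An unjoined pair stays unjoined when both sets are shrunk, so the union bound may run
  over sets of size exactly \<open>s\<close>, the size to which (P5) applies.\<close>

lemma not_joins_large_sets_imp_avoids:
  assumes "\<not> joins_large_sets n (traversed xs)"
  defines "s \<equiv> nat \<lceil>large_size n\<rceil>"
  shows "\<exists>A B. A \<subseteq> {1..n} \<and> B \<subseteq> {1..n} \<and> A \<inter> B = {} \<and> card A = s \<and> card B = s \<and> avoids (crosses A B) xs"
proof -
  obtain A B where AB: "A \<subseteq> {1..n}" "B \<subseteq> {1..n}" "A \<inter> B = {}"
      "large_size n \<le> real (card A)" "large_size n \<le> real (card B)"
    and none: "\<not> (\<exists>a\<in>A. \<exists>b\<in>B. {a, b} \<in># traversed xs)"
    using assms(1) unfolding joins_large_sets_def by blast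
  have s: "s \<le> card A" "s \<le> card B" using AB(4,5) by (simp_all add: s_def ceiling_le_iff nat_le_iff)
  obtain A' where A': "A' \<subseteq> A" "card A' = s" by (rule obtain_subset_with_card_n[OF s(1)])
  obtain B' where B': "B' \<subseteq> B" "card B' = s" by (rule obtain_subset_with_card_n[OF s(2)])
  have disj: "A' \<inter> B' = {}" using A'(1) B'(1) AB(3) by auto
  have "\<not> (\<exists>a\<in>A'. \<exists>b\<in>B'. {a, b} \<in># traversed xs)" using none A'(1) B'(1) by auto
  then have "avoids (crosses A' B') xs" using not_avoids_crosses_imp_traversed[OF disj] by blast
  moreover have "A' \<subseteq> {1..n}" "B' \<subseteq> {1..n}" using A'(1) B'(1) AB(1,2) by auto
  ultimately show ?thesis using disj A'(2) B'(2) by (intro exI[of _ A'] exI[of _ B']) simp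
qed

text \<open>Each pair of sets costs at most \<open>c\<close>, and there are at most exp(2 s (1 + ln
  ln n)) pairs. The third condition on \<open>n\<close> makes the decay in \<open>c\<close> outweigh
  this count with a margin of exp(- s / 2), and \<open>s\<close> is at least ln n.\<close>

lemma prob_not_joins_large_sets_le:
  fixes \<alpha> :: real and n L :: nat
  defines "s \<equiv> nat \<lceil>large_size n\<rceil>" and "l \<equiv> ln (ln (real n)) powr (3/2)"
  assumes E: "graph_on n E" "degrees_ok n \<alpha> E" "edge_expanding n \<alpha> E" "few_poorly_joined n \<alpha> E"
    and \<alpha>: "0 < \<alpha>" and v: "v \<in> {1..n}"
    and L: "real n * ln (real n) \<le> real L"
    and n: "1 \<le> ln (ln (real n))" "ln (real n) \<le> large_size n" "8000 * (7 + 4 * ln (ln (real n))) \<le> l"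
  shows "measure_pmf.prob (walk_trace E v L) {\<Gamma>. \<not> joins_large_sets n \<Gamma>} \<le> sqrt (1 / real n)"
proof -
  define lln where "lln = ln (ln (real n))"
  define c where "c = sqrt (8 / 5 * real n * exp (- (real s * l / 8000)))"
  have n0: "0 < n" using v by auto
  have "0 < ln (real n)"
  \<comment> \<open>Since \<open>ln 0\<close> is 0, the remaining case ln n = 0 contradicts
    \<open>1 \<le> ln (ln (real n))\<close>.\<close>
  proof (rule ccontr)
    assume "\<not> 0 < ln (real n)"
    then have "ln (real n) = 0" using n0 by simp
    then show False using n(1) by simp
  qed
  then have ln1: "1 < ln (real n)" using n(1) by (smt (verit) ln_le_zero_iff)
  have l1: "1 \<le> l" using n(1) by (simp add: l_def ge_one_powr_ge_zero)
  have l0: "0 \<le> l" by (simp add: l_def)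
  have sl: "large_size n \<le> real s" by (simp add: s_def real_nat_ceiling_ge)
  have s_ln: "ln (real n) \<le> real s" using sl n(2) by simp
  have s1: "1 < real s" using s_ln ln1 by simp
  have s_int: "int s = \<lceil>large_size n\<rceil>" using ln1 n(2) by (simp add: s_def)
  \<comment> \<open>As \<open>s\<close> is at least n l / ln n and \<open>l\<close> at least 1, the
    ratio n / s is at most ln n, which serves as \<open>r\<close> in the binomial bound.\<close>
  have "real n * l \<le> real s * ln (real n)"
    using sl ln1 by (simp add: large_size_def l_def divide_le_eq)
  moreover have "real n * 1 \<le> real n * l" using l1 by (intro mult_left_mono) auto
  ultimately have choose: "real (n choose s) \<le> exp (real s * (1 + lln))"
    unfolding lln_def using s1 ln1 by (intro binomial_le_exp) auto
  define I where "I = {(A, B). A \<subseteq> {1..n} \<and> B \<subseteq> {1..n} \<and> A \<inter> B = {} \<and> card A = s \<and> card B = s}"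
  define K where "K = {A. A \<subseteq> {1..n} \<and> card A = s}"
  have K: "finite K" "card K = n choose s" using n_subsets[of "{1..n}" s] by (simp_all add: K_def)
  have IK: "I \<subseteq> K \<times> K" by (auto simp: I_def K_def)
  then have fI: "finite I" using K finite_subset by blast
  have "card I \<le> (n choose s) * (n choose s)"
    using card_mono[OF _ IK] K by (simp add: card_cartesian_product)
  then have cI: "real (card I) \<le> real (n choose s) * real (n choose s)"
    by (metis of_nat_le_iff of_nat_mult)
  have pair: "measure_pmf.prob (lazy_walk E v L) {xs. avoids (crosses A B) xs} \<le> c" if "(A, B) \<in> I" for A B
  proof -
    have AB: "A \<subseteq> {1..n}" "B \<subseteq> {1..n}" "A \<inter> B = {}" "card A = s" "card B = s" using that by (auto simp: I_def)
    have M: "real s * \<alpha> * l / 4 \<le> (\<Sum>x\<in>{1..n}. \<Sum>y\<in>{1..n}. of_bool ({x, y} \<in> E \<and> crosses A B x y))"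
      using few_poorly_joined_imp_edges_between[OF E(4) _ AB(1-3)] \<alpha> AB(4,5) s_int by (simp add: l_def)
    have "(measure_pmf.prob (lazy_walk E v L) {xs. avoids (crosses A B) xs})\<^sup>2
      \<le> 8 / 5 * real n * exp (- (real s * \<alpha> * l / 4 * real L / (2000 * real n * (\<alpha> * ln (real n)))))"
      using \<alpha> ln1 AB(3) by (intro prob_lazy_walk_avoids_le E M v) (auto simp: crosses_def)
    also have "\<dots> \<le> 8 / 5 * real n * exp (- (real s * l / 8000))"
    \<comment> \<open>With M = s \<alpha> l / 4 and a walk of at least n ln n steps, \<alpha>, n and
      ln n cancel, leaving 4 * 2000 = 8000.\<close>
    proof -
      have "real s * l / 8000 = real s * l / 8000 * (real n * ln (real n)) / (real n * ln (real n))"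
        using n0 ln1 by (subst nonzero_mult_div_cancel_right) auto
      also have "\<dots> \<le> real s * l / 8000 * real L / (real n * ln (real n))"
        using L l0 ln1 by (intro divide_right_mono mult_left_mono) auto
      also have "\<dots> = real s * \<alpha> * l / 4 * real L / (2000 * real n * (\<alpha> * ln (real n)))"
        using n0 ln1 \<alpha> by (simp add: field_simps)
      finally show ?thesis by (intro mult_left_mono) auto
    qed
    finally show ?thesis unfolding c_def by (rule real_le_rsqrt)
  qed
  have "measure_pmf.prob (walk_trace E v L) {\<Gamma>. \<not> joins_large_sets n \<Gamma>}
      = measure_pmf.prob (lazy_walk E v L) {xs. \<not> joins_large_sets n (traversed xs)}"
    by (simp add: walk_trace_def vimage_def)
  also have "\<dots> \<le> measure_pmf.prob (lazy_walk E v L) (\<Union>(A, B)\<in>I. {xs. avoids (crosses A B) xs})"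
    by (intro measure_pmf.finite_measure_mono)
      (use not_joins_large_sets_imp_avoids in \<open>fastforce simp: I_def s_def\<close>)+
  also have "\<dots> \<le> (\<Sum>(A, B)\<in>I. measure_pmf.prob (lazy_walk E v L) {xs. avoids (crosses A B) xs})"
    using measure_pmf.finite_measure_subadditive_finite[OF fI, of "\<lambda>(A, B). {xs. avoids (crosses A B) xs}" "lazy_walk E v L"]
    by (simp add: case_prod_beta)
  also have "\<dots> \<le> (\<Sum>(A, B)\<in>I. c)" by (intro sum_mono) (auto intro: pair)
  also have "\<dots> = real (card I) * c" by (simp add: case_prod_beta)
  also have "\<dots> \<le> (exp (real s * (1 + lln)) * exp (real s * (1 + lln))) * c"
    using cI mult_mono[OF choose choose] by (intro mult_right_mono) (auto simp: c_def)
  also have "\<dots> \<le> sqrt (1 / real n)"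
  \<comment> \<open>Squaring removes the root in \<open>c\<close>. The exponent becomes 4 s (1 + ln
    ln n) from the pairs, 2 s from absorbing 8/5 n, and - s l / 8000; by the third condition on
    \<open>n\<close> the sum is at most - s.\<close>
  proof (rule real_le_rsqrt)
    have "8 / 5 \<le> exp (1 :: real)" using exp_ge_add_one_self[of 1] by linarith
    then have "8 / 5 * real n \<le> exp 1 * exp (ln (real n))" using n0 by (intro mult_mono) auto
    also have "\<dots> \<le> exp (2 * real s)" using s_ln s1 by (simp add: exp_add[symmetric])
    finally have n_le: "8 / 5 * real n \<le> exp (2 * real s)" .
    have "exp (real s * (1 + lln)) * exp (real s * (1 + lln)) = exp (2 * real s * (1 + lln))"
      by (simp add: mult_exp_exp)
    moreover have "(exp (2 * real s * (1 + lln)))\<^sup>2 = exp (4 * real s * (1 + lln))"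
      unfolding power2_eq_square mult_exp_exp by simp
    moreover have "c\<^sup>2 = 8 / 5 * real n * exp (- (real s * l / 8000))" by (simp add: c_def)
    ultimately have "(exp (real s * (1 + lln)) * exp (real s * (1 + lln)) * c)\<^sup>2
        = exp (4 * real s * (1 + lln)) * (8 / 5 * real n * exp (- (real s * l / 8000)))"
      by (simp only: power_mult_distrib)
    also have "\<dots> \<le> exp (4 * real s * (1 + lln)) * (exp (2 * real s) * exp (- (real s * l / 8000)))"
      using n_le by (intro mult_left_mono mult_right_mono) auto
    also have "\<dots> = exp (real s * (6 + 4 * lln - l / 8000))"
      by (simp add: mult_exp_exp algebra_simps)
    also have "\<dots> \<le> exp (real s * (- 1))"
      using n(3) by (intro iffD2[OF exp_le_cancel_iff] mult_left_mono) (auto simp: lln_def)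
    also have "\<dots> \<le> exp (- ln (real n))" using s_ln by simp
    also have "\<dots> = 1 / real n" using n0 by (simp add: exp_minus inverse_eq_divide)
    finally show "(exp (real s * (1 + lln)) * exp (real s * (1 + lln)) * c)\<^sup>2 \<le> 1 / real n" .
  qed
  finally show ?thesis .
qed

theorem theorem3p9:
  "\<exists>\<epsilon>0>0. \<forall>\<epsilon>::real. 0 < \<epsilon> \<and> \<epsilon> < \<epsilon>0 \<longrightarrow>
     (\<forall>(\<alpha> :: nat \<Rightarrow> real) (G :: nat \<Rightarrow> graph) (v0 :: nat \<Rightarrow> nat).
        (\<forall>n. \<alpha> n \<ge> 1500 / \<epsilon>\<^sup>2) \<longrightarrow>
        pseudo_random \<alpha> G \<longrightarrow>
        (\<forall>n\<ge>1. v0 n \<in> {1..n}) \<longrightarrow>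
        (\<lambda>n. measure_pmf.prob
               (walk_trace (G n) (v0 n) (nat \<lfloor>(2 + \<epsilon>) * real n * ln (real n)\<rfloor>))
               {\<Gamma>. \<forall>A B. A \<subseteq> {1..n} \<longrightarrow> B \<subseteq> {1..n} \<longrightarrow> A \<inter> B = {} \<longrightarrow>
                  real (card A) \<ge> large_size n \<longrightarrow> real (card B) \<ge> large_size n \<longrightarrow>
                  (\<exists>a\<in>A. \<exists>b\<in>B. {a, b} \<in># \<Gamma>)})
          \<longlonglongrightarrow> 1)"
proof (intro exI[of _ 1] conjI allI impI)
  fix \<epsilon> :: real and \<alpha> :: "nat \<Rightarrow> real" and G :: "nat \<Rightarrow> graph" and v0 :: "nat \<Rightarrow> nat"
  assume \<epsilon>: "0 < \<epsilon> \<and> \<epsilon> < 1" and pr: "pseudo_random \<alpha> G" and v0: "\<forall>n\<ge>1. v0 n \<in> {1..n}"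
  define L where "L n = nat \<lfloor>(2 + \<epsilon>) * real n * ln (real n)\<rfloor>" for n
  define p where "p n = measure_pmf.prob (walk_trace (G n) (v0 n) (L n)) {\<Gamma>. joins_large_sets n \<Gamma>}" for n
  have good: "\<forall>\<^sub>F n in sequentially. \<alpha> n > 0 \<and> graph_on n (G n) \<and> graph_connected n (G n) \<and>
        degrees_ok n (\<alpha> n) (G n) \<and> edge_expanding n (\<alpha> n) (G n) \<and>
        few_poorly_joined n (\<alpha> n) (G n) \<and> locally_sparse n (\<alpha> n) (G n)"
    using pr by (simp add: pseudo_random_def)
  \<comment> \<open>The third estimate rests on 3/2 > 1: the power of ln ln n outgrows every linear
    function of ln ln n, hence the entropy of the choice of (A, B).\<close>
  have "\<forall>\<^sub>F n in sequentially. 1 \<le> ln (ln (real n))"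
    and "\<forall>\<^sub>F n in sequentially. ln (real n) \<le> large_size n"
    and "\<forall>\<^sub>F n in sequentially. 8000 * (7 + 4 * ln (ln (real n))) \<le> ln (ln (real n)) powr (3/2)"
    and "\<forall>\<^sub>F n in sequentially. 1 \<le> real n * ln (real n)"
    unfolding large_size_def by real_asymp+
  with good eventually_ge_at_top[of 1]
  have lower: "\<forall>\<^sub>F n in sequentially. 1 - sqrt (1 / real n) \<le> p n"
  proof eventually_elim
    case (elim n)
    \<comment> \<open>Rounding down costs at most 1, covered by the surplus (1 + \<epsilon>) n ln n
      once \<open>1 \<le> real n * ln (real n)\<close>.\<close>
    have "real n * ln (real n) \<le> (2 + \<epsilon>) * real n * ln (real n) - 1"
    proof -
      have "0 \<le> \<epsilon> * (real n * ln (real n))" using \<epsilon> elim by auto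
      then show ?thesis using elim by (simp add: algebra_simps)
    qed
    also have "\<dots> \<le> real (L n)" unfolding L_def by linarith
    finally have "measure_pmf.prob (walk_trace (G n) (v0 n) (L n)) {\<Gamma>. \<not> joins_large_sets n \<Gamma>} \<le> sqrt (1 / real n)"
      using elim v0 by (intro prob_not_joins_large_sets_le[where \<alpha>="\<alpha> n"]) auto
    moreover have "p n = 1 - measure_pmf.prob (walk_trace (G n) (v0 n) (L n)) {\<Gamma>. \<not> joins_large_sets n \<Gamma>}"
      unfolding p_def by (subst measure_pmf.prob_compl[symmetric]) (auto intro!: arg_cong[where f="measure_pmf.prob _"])
    ultimately show ?case by linarith
  qed
  have "p \<longlonglongrightarrow> 1"
  proof (rule tendsto_sandwich[OF lower])
    show "\<forall>\<^sub>F n in sequentially. p n \<le> 1" by (simp add: p_def)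
    show "(\<lambda>n. 1 - sqrt (1 / real n)) \<longlonglongrightarrow> 1" by real_asymp
  qed simp
  then show "(\<lambda>n. measure_pmf.prob
               (walk_trace (G n) (v0 n) (nat \<lfloor>(2 + \<epsilon>) * real n * ln (real n)\<rfloor>))
               {\<Gamma>. \<forall>A B. A \<subseteq> {1..n} \<longrightarrow> B \<subseteq> {1..n} \<longrightarrow> A \<inter> B = {} \<longrightarrow>
                  real (card A) \<ge> large_size n \<longrightarrow> real (card B) \<ge> large_size n \<longrightarrow>
                  (\<exists>a\<in>A. \<exists>b\<in>B. {a, b} \<in># \<Gamma>)})
          \<longlonglongrightarrow> 1"
    by (simp only: p_def[abs_def] L_def joins_large_sets_def[abs_def])
qed simp

end
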